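(* If $G_1$ and $G_2$ are connected unicyclic graphs whose cycles have different sizes, then $\mathbf{X}_{G_1}\neq\mathbf{X}_{G_2}$.
   Context: All graphs are finite and simple. The chromatic symmetric function of a graph $G$ with vertices $v_1,\dots,v_n$ is $\mathbf{X}_G=\sum_\kappa x_{\kappa(v_1)}\cdots x_{\kappa(v_n)}$, summed over all proper colorings $\kappa:V(G)\to\mathbb{N}$. A unicyclic graph is a graph containing exactly one cycle. *)

theory Defs
  imports
    "Graph_Theory.Pair_Digraph"
    "Graph_Theory.Digraph_Component"
    "HOL-Library.Multiset"
    "HOL-Library.FuncSet"
begin

text \<open>
  A finite simple graph is a \<^locale>\<open>pair_graph\<close>: a finite, loop-free, symmetric digraph without
  parallel arcs, in which an edge $uv$ is represented by the two arcs $(u,v)$ and $(v,u)$.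
\<close>

text \<open>
  In a symmetric digraph the closed walk $u,v,u$ counts as a \<^const>\<open>pre_digraph.cycle\<close>, so cycles
  of an undirected graph need length at least 3. Moreover, a cycle is a subgraph, not a walk:
  the walks that differ only in starting point or orientation all trace the same cycle.
\<close>

definition walk_subgraph :: "('a \<times> 'a) list \<Rightarrow> 'a pair_pre_digraph" where
  "walk_subgraph p = \<lparr> pverts = fst ` set p, parcs = set p \<union> (set p)\<inverse> \<rparr>"

definition graph_cycles :: "'a pair_pre_digraph \<Rightarrow> 'a pair_pre_digraph set" where
  "graph_cycles G = {walk_subgraph p | p. pre_digraph.cycle (with_proj G) p \<and> 3 \<le> length p}"

definition unicyclic :: "'a pair_pre_digraph \<Rightarrow> bool" where
  "unicyclic G \<longleftrightarrow> (\<exists>!C. C \<in> graph_cycles G)"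

definition proper_colorings :: "'a pair_pre_digraph \<Rightarrow> ('a \<Rightarrow> nat) set" where
  "proper_colorings G = {\<kappa> \<in> pverts G \<rightarrow>\<^sub>E UNIV. \<forall>(u, v) \<in> parcs G. \<kappa> u \<noteq> \<kappa> v}"

text \<open>
  The monomial $x_{i_1} \cdots x_{i_n}$ is encoded as the multiset of the indices $i_1, \dots, i_n$.
\<close>

definition coloring_monomial :: "'a pair_pre_digraph \<Rightarrow> ('a \<Rightarrow> nat) \<Rightarrow> nat multiset" where
  "coloring_monomial G \<kappa> = image_mset \<kappa> (mset_set (pverts G))"

text \<open>
  A formal power series in $x_0, x_1, \dots$ is encoded by its coefficient function. The
  coefficient of $m$ in the sum of the monomials of all proper colorings is the number of
  colorings with monomial $m$, which is finite by \<open>finite_colorings_with_monomial\<close> below.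
\<close>

definition chromatic_symmetric_function :: "'a pair_pre_digraph \<Rightarrow> nat multiset \<Rightarrow> int" where
  "chromatic_symmetric_function G m =
     int (card {\<kappa> \<in> proper_colorings G. coloring_monomial G \<kappa> = m})"

lemma finite_colorings_with_monomial:
  assumes "pair_graph G"
  shows "finite {\<kappa> \<in> proper_colorings G. coloring_monomial G \<kappa> = m}"
proof -
  interpret pair_graph G by fact
  have "finite (pverts G)" by (rule pair_finite_verts)
  then have "finite (pverts G \<rightarrow>\<^sub>E set_mset m)" by (intro finite_PiE) auto
  moreover have "{\<kappa> \<in> proper_colorings G. coloring_monomial G \<kappa> = m} \<subseteq> pverts G \<rightarrow>\<^sub>E set_mset m"
    using \<open>finite (pverts G)\<close> by (auto simp: proper_colorings_def coloring_monomial_def PiE_iff extensional_def)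
  ultimately show ?thesis by (rule rev_finite_subset)
qed

end

theory Submission
  imports Defs
begin

text \<open>
  The chromatic symmetric function determines the number \<open>n\<close> of vertices, as the common degree of
  its monomials, and the chromatic polynomial. For a connected graph whose only cycle has length
  \<open>c\<close>, the latter is \<open>((k - 1)^c + (-1)^c (k - 1)) (k - 1)^(n - c)\<close>: the first factor counts the
  colorings of the cycle, and every other vertex is attached as a pendant vertex. At \<open>k = 3\<close> the value
  is \<open>2^n + (-1)^c 2^(n - c + 1)\<close>, which determines \<open>c\<close>.
\<close>

section \<open>Proper colorings with \<open>k\<close> colors: pendant vertices and
  relabeling\<close>

text \<open>Arcs with an endpoint outside \<open>S\<close> are ignored, so these are the colorings
  of the subgraph induced by \<open>S\<close>, and \<open>E\<close> can stay fixed while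
  \<open>S\<close> grows.\<close>

definition k_colorings :: "nat \<Rightarrow> ('a \<times> 'a) set \<Rightarrow> 'a set \<Rightarrow> ('a \<Rightarrow> nat) set" where
  "k_colorings k E S =
     {\<kappa> \<in> S \<rightarrow>\<^sub>E {..<k}. \<forall>(u, v) \<in> E. u \<in> S \<longrightarrow> v \<in> S \<longrightarrow> \<kappa> u \<noteq> \<kappa> v}"

lemma finite_k_colorings: "finite S \<Longrightarrow> finite (k_colorings k E S)"
  by (rule finite_subset[of _ "S \<rightarrow>\<^sub>E {..<k}"]) (auto simp: k_colorings_def intro: finite_PiE)

text \<open>The color of \<open>v\<close> has to avoid only that of \<open>w\<close>, so every
  coloring of \<open>S\<close> extends in \<open>k - 1\<close> ways.\<close>

lemma card_k_colorings_insert_pendant: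
  assumes "finite S" "v \<notin> S" "(v, v) \<notin> E"
    and w: "{u \<in> S. (u, v) \<in> E \<or> (v, u) \<in> E} = {w}"
  shows "card (k_colorings k E (insert v S)) = (k - 1) * card (k_colorings k E S)"
proof -
  let ?B = "SIGMA \<kappa>:k_colorings k E S. {..<k} - {\<kappa> w}"
  have wS: "w \<in> S" and nb: "\<And>u. u \<in> S \<Longrightarrow> (u, v) \<in> E \<or> (v, u) \<in> E \<longleftrightarrow> u = w" using w by auto
  have "bij_betw (\<lambda>f. (restrict f S, f v)) (k_colorings k E (insert v S)) ?B"
  proof (rule bij_betw_byWitness[where f' = "\<lambda>(\<kappa>, c). \<kappa>(v := c)"])
    show "\<forall>f\<in>k_colorings k E (insert v S). (case (restrict f S, f v) of (\<kappa>, c) \<Rightarrow> \<kappa>(v := c)) = f"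
      by (auto simp: k_colorings_def fun_eq_iff PiE_iff extensional_def)
    show "\<forall>b\<in>?B. (restrict (case b of (\<kappa>, c) \<Rightarrow> \<kappa>(v := c)) S, (case b of (\<kappa>, c) \<Rightarrow> \<kappa>(v := c)) v) = b"
      using assms(2) by (auto simp: k_colorings_def fun_eq_iff PiE_iff extensional_def)
    show "(\<lambda>f. (restrict f S, f v)) ` k_colorings k E (insert v S) \<subseteq> ?B"
    proof (rule image_subsetI)
      fix f assume f: "f \<in> k_colorings k E (insert v S)"
      have "f v \<noteq> f w" using f nb[OF wS] wS by (fastforce simp: k_colorings_def)
      then show "(restrict f S, f v) \<in> ?B"
        using f wS by (auto simp: k_colorings_def PiE_iff)
    qed
    show "(\<lambda>(\<kappa>, c). \<kappa>(v := c)) ` ?B \<subseteq> k_colorings k E (insert v S)"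
    proof (rule image_subsetI)
      fix b assume "b \<in> ?B"
      then obtain \<kappa> c where b: "b = (\<kappa>, c)" and k: "\<kappa> \<in> k_colorings k E S" and c: "c < k" "c \<noteq> \<kappa> w"
        by auto
      have "\<kappa>(v := c) \<in> k_colorings k E (insert v S)"
        unfolding k_colorings_def
      proof (rule CollectI, intro conjI ballI, goal_cases)
        case 1 then show ?case using k c by (auto simp: k_colorings_def PiE_iff extensional_def)
      next
        case (2 e)
        then show ?case using k c nb assms(2,3) by (cases e) (auto simp: k_colorings_def)
      qed
      then show "(case b of (\<kappa>, c) \<Rightarrow> \<kappa>(v := c)) \<in> k_colorings k E (insert v S)" by (simp add: b)
    qed
  qed
  then have "card (k_colorings k E (insert v S)) = card ?B" by (rule bij_betw_same_card)
  also have "\<dots> = (\<Sum>\<kappa>\<in>k_colorings k E S. card ({..<k} - {\<kappa> w}))"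
    by (simp add: finite_k_colorings assms(1))
  \<comment> \<open>Since \<open>w \<in> S\<close>, the color \<open>\<kappa> w\<close> is below
    \<open>k\<close>, so exactly one color is removed.\<close>
  also have "\<dots> = (\<Sum>\<kappa>\<in>k_colorings k E S. k - 1)"
    by (rule sum.cong) (use wS in \<open>force simp: k_colorings_def card_Diff_singleton PiE_iff\<close>)+
  finally show ?thesis by simp
qed

text \<open>Adjacency is compared up to direction, because the arcs of \<open>cycle_arcs\<close> run
  one way while those of a graph come in both directions.\<close>

lemma card_k_colorings_bij:
  assumes h: "bij_betw h A B"
    and adj: "\<And>i j. i \<in> A \<Longrightarrow> j \<in> A \<Longrightarrow>
      (i, j) \<in> E \<or> (j, i) \<in> E \<longleftrightarrow> (h i, h j) \<in> F \<or> (h j, h i) \<in> F"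
  shows "card (k_colorings k E A) = card (k_colorings k F B)"
proof -
  let ?g = "inv_into A h"
  have hA: "\<And>i. i \<in> A \<Longrightarrow> h i \<in> B" using h by (auto simp: bij_betw_def)
  have gB: "\<And>b. b \<in> B \<Longrightarrow> ?g b \<in> A" using bij_betw_inv_into[OF h] by (auto simp: bij_betw_def)
  have hg: "\<And>b. b \<in> B \<Longrightarrow> h (?g b) = b" using h by (meson bij_betw_inv_into_right)
  have gh: "\<And>a. a \<in> A \<Longrightarrow> ?g (h a) = a" using h by (meson bij_betw_inv_into_left)
  have "bij_betw (\<lambda>f. restrict (f \<circ> ?g) B) (k_colorings k E A) (k_colorings k F B)"
  proof (rule bij_betw_byWitness[where f' = "\<lambda>f. restrict (f \<circ> h) A"])
    show "\<forall>f\<in>k_colorings k E A. restrict (restrict (f \<circ> ?g) B \<circ> h) A = f"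
      using hA gh by (auto simp: k_colorings_def fun_eq_iff PiE_iff extensional_def)
    show "\<forall>f\<in>k_colorings k F B. restrict (restrict (f \<circ> h) A \<circ> ?g) B = f"
      using gB hg by (auto simp: k_colorings_def fun_eq_iff PiE_iff extensional_def)
    show "(\<lambda>f. restrict (f \<circ> ?g) B) ` k_colorings k E A \<subseteq> k_colorings k F B"
    proof (rule image_subsetI)
      fix f assume f: "f \<in> k_colorings k E A"
      have "f (?g u) \<noteq> f (?g v)" if "(u, v) \<in> F" "u \<in> B" "v \<in> B" for u v
        using f adj[of "?g u" "?g v"] that gB hg by (fastforce simp: k_colorings_def)
      then show "restrict (f \<circ> ?g) B \<in> k_colorings k F B"
        using f gB by (auto simp: k_colorings_def PiE_iff)
    qed
    show "(\<lambda>f. restrict (f \<circ> h) A) ` k_colorings k F B \<subseteq> k_colorings k E A"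
    proof (rule image_subsetI)
      fix f assume f: "f \<in> k_colorings k F B"
      have "f (h u) \<noteq> f (h v)" if "(u, v) \<in> E" "u \<in> A" "v \<in> A" for u v
        using f adj[of u v] that hA by (fastforce simp: k_colorings_def)
      then show "restrict (f \<circ> h) A \<in> k_colorings k E A"
        using f hA by (auto simp: k_colorings_def PiE_iff)
    qed
  qed
  then show ?thesis by (rule bij_betw_same_card)
qed

section \<open>Paths and cycles on initial segments of the naturals\<close>

lemma card_k_colorings_path:
  "card (k_colorings k {(i, Suc i) | i. True} {..<Suc m}) = k * (k - 1) ^ m"
proof (induction m)
  case 0
  have "k_colorings k {(i, Suc i) | i. True} {..<Suc 0} = {0} \<rightarrow>\<^sub>E {..<k}"
    by (auto simp: k_colorings_def lessThan_Suc)
  then show ?case by (simp add: card_PiE)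
next
  case (Suc m)
  have "card (k_colorings k {(i, Suc i) | i. True} (insert (Suc m) {..<Suc m}))
      = (k - 1) * card (k_colorings k {(i, Suc i) | i. True} {..<Suc m})"
    by (rule card_k_colorings_insert_pendant[where w = m]) auto
  then show ?case using Suc by (simp add: lessThan_Suc)
qed

text \<open>
  For \<open>m = 1\<close> this is a loop, so that there are no proper colorings, in accordance with the
  general formula.
\<close>

definition cycle_arcs :: "nat \<Rightarrow> (nat \<times> nat) set" where
  "cycle_arcs m = {(i, Suc i mod m) | i. i < m}"

lemma cycle_arcs_Suc: "cycle_arcs (Suc m) = insert (m, 0) {(i, Suc i) | i. i < m}"
proof -
  have "{(i, Suc i mod Suc m) | i. i < Suc m} = (\<lambda>i. (i, Suc i mod Suc m)) ` insert m {..<m}"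
    by (auto simp: less_Suc_eq)
  also have "\<dots> = insert (m, 0) {(i, Suc i) | i. i < m}"
    by (auto simp: image_iff)
  finally show ?thesis by (simp only: cycle_arcs_def)
qed

text \<open>
  The colorings of the path on \<open>m + 1\<close> vertices split into those of the cycle on \<open>m + 1\<close>
  vertices (ends colored differently) and those of the cycle on \<open>m\<close> vertices (ends identified).
\<close>

lemma card_k_colorings_cycle_Suc:
  assumes "m > 0"
  shows "card (k_colorings k (cycle_arcs (Suc m)) {..<Suc m}) + card (k_colorings k (cycle_arcs m) {..<m})
    = k * (k - 1) ^ m"
proof -
  let ?P = "k_colorings k {(i, Suc i) | i. True} {..<Suc m}"
  let ?N = "{f \<in> ?P. f m \<noteq> f 0}" and ?Q = "{f \<in> ?P. f m = f 0}"
  \<comment> \<open>With \<open>m = Suc l\<close>, \<open>cycle_arcs_Suc\<close> also unfolds the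
    cycle on \<open>m\<close> vertices, whose closing arc is \<open>(l, 0)\<close>.\<close>
  obtain l where l: "m = Suc l" using assms by (cases m) auto
  have N: "k_colorings k (cycle_arcs (Suc m)) {..<Suc m} = ?N"
    unfolding cycle_arcs_Suc by (fastforce simp: k_colorings_def)
  have "bij_betw (\<lambda>f. restrict f {..<m}) ?Q (k_colorings k (cycle_arcs m) {..<m})"
  proof (rule bij_betw_byWitness[where f' = "\<lambda>f. f(m := f 0)"])
    show "\<forall>f\<in>?Q. (restrict f {..<m})(m := restrict f {..<m} 0) = f"
      using assms by (auto simp: k_colorings_def fun_eq_iff PiE_iff extensional_def)
    show "\<forall>f\<in>k_colorings k (cycle_arcs m) {..<m}. restrict (f(m := f 0)) {..<m} = f"
      by (auto simp: k_colorings_def fun_eq_iff PiE_iff extensional_def)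
    show "(\<lambda>f. restrict f {..<m}) ` ?Q \<subseteq> k_colorings k (cycle_arcs m) {..<m}"
    proof (rule image_subsetI)
      fix f assume f: "f \<in> ?Q"
      have step: "f i \<noteq> f (Suc i)" if "i < m" for i using f that by (fastforce simp: k_colorings_def)
      \<comment> \<open>The path arc \<open>(l, m)\<close> supplies the closing arc
        \<open>(l, 0)\<close>, since \<open>f m = f 0\<close>.\<close>
      show "restrict f {..<m} \<in> k_colorings k (cycle_arcs m) {..<m}"
        using f step step[of l] unfolding l cycle_arcs_Suc
        by (auto simp: k_colorings_def PiE_iff)
    qed
    show "(\<lambda>f. f(m := f 0)) ` k_colorings k (cycle_arcs m) {..<m} \<subseteq> ?Q"
    proof (rule image_subsetI)
      fix f assume f: "f \<in> k_colorings k (cycle_arcs m) {..<m}"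
      have step: "f i \<noteq> f (Suc i)" if "i < l" for i
        using f that unfolding l cycle_arcs_Suc by (fastforce simp: k_colorings_def)
      have "f l \<noteq> f 0" using f unfolding l cycle_arcs_Suc by (fastforce simp: k_colorings_def)
      then show "f(m := f 0) \<in> ?Q"
        using f step unfolding l
        by (auto simp: k_colorings_def PiE_iff extensional_def less_Suc_eq)
    qed
  qed
  then have Q: "card ?Q = card (k_colorings k (cycle_arcs m) {..<m})" by (rule bij_betw_same_card)
  have fin: "finite ?P" by (rule finite_k_colorings) simp
  have "card ?N + card ?Q = card (?N \<union> ?Q)"
    by (rule card_Un_disjoint[symmetric]) (use fin in auto)
  also have "?N \<union> ?Q = ?P" by blast
  finally show ?thesis using N Q by (simp only: card_k_colorings_path)
qed

text \<open>Solves the recursion a(m + 1) = k (k - 1)^m - a(m): the first term of the formula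
  becomes (k - 1)^(m + 1) and the sign of the second flips. It starts at the loop, where the two
  terms cancel.\<close>

lemma card_k_colorings_cycle:
  assumes "m > 0" "k > 0"
  shows "int (card (k_colorings k (cycle_arcs m) {..<m})) = (int k - 1) ^ m + (-1) ^ m * (int k - 1)"
  using assms(1)
proof (induction m rule: nat_induct_non_zero)
  case 1
  have "k_colorings k (cycle_arcs 1) {..<1} = {}"
    using cycle_arcs_Suc[of 0] by (auto simp: k_colorings_def)
  then show ?case by simp
next
  case (Suc m)
  have "int (card (k_colorings k (cycle_arcs (Suc m)) {..<Suc m}))
      + int (card (k_colorings k (cycle_arcs m) {..<m})) = int k * (int k - 1) ^ m"
    using arg_cong[OF card_k_colorings_cycle_Suc[OF Suc(1), of k], of int] assms(2)
    by (simp add: of_nat_diff)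
  then show ?case using Suc by (simp add: algebra_simps)
qed

section \<open>Cycles as vertex lists, and uniqueness of the cycle\<close>

lemma (in pre_digraph) cas_nth:
  assumes "cas u p v" "i < length p"
  shows "head G (p ! i) = (if Suc i < length p then tail G (p ! Suc i) else v)"
  using assms
proof (induction p arbitrary: u i)
  case (Cons e p)
  then show ?case by (cases i; cases p) auto
qed simp

text \<open>The list \<open>xs\<close> consists of the tails of the arcs of a closed walk tracing
  \<open>C\<close>. Indexing by it turns \<open>cycle_arcs\<close>, taken in both directions, into
  the arcs of \<open>C\<close>, so the count for cycles on indices carries over.\<close>

lemma (in pair_graph) graph_cycleE:
  assumes "C \<in> graph_cycles G"
  obtains xs where "distinct xs" "xs \<noteq> []" "pverts C = set xs"
    "set xs \<subseteq> pverts G" "parcs C \<subseteq> parcs G" "parcs C \<subseteq> set xs \<times> set xs"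
    "parcs C = (\<Union>(i, j)\<in>cycle_arcs (length xs). {(xs ! i, xs ! j), (xs ! j, xs ! i)})"
proof -
  obtain p where p: "cycle p" and C: "C = walk_subgraph p"
    using assms by (auto simp: graph_cycles_def)
  obtain u where w: "awalk u p u" and d: "distinct (tl (awalk_verts u p))" and ne: "p \<noteq> []"
    using p by (auto simp: cycle_def)
  have cas: "cas u p u" and pE: "set p \<subseteq> parcs G" using w by (auto simp: awalk_def)
  let ?xs = "map fst p"
  have hd: "fst (p ! 0) = u" using cas ne by (cases p) auto
  have av: "awalk_verts u p = ?xs @ [u]"
    using awalk_verts_conv[of u p] cas_nth[OF cas, of "length p - 1"] ne by (auto simp: last_conv_nth)
  \<comment> \<open>The distinct list \<open>tl (awalk_verts u p)\<close> leaves out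
    \<open>u\<close> at the start; \<open>?xs\<close> leaves it out at the end, with the same
    vertices.\<close>
  have dist: "distinct ?xs" using d av hd ne by (cases p) auto
  have arc: "p ! i = (?xs ! i, ?xs ! (Suc i mod length p))" if "i < length p" for i
  proof (cases "Suc i < length p")
    case True
    then show ?thesis using cas_nth[OF cas that] that by (simp add: prod_eq_iff)
  next
    \<comment> \<open>The last arc returns to \<open>u\<close>, the entry at index 0; this is where
      \<open>mod\<close> wraps around.\<close>
    case False
    then have "Suc i = length p" using that by simp
    then show ?thesis using cas_nth[OF cas that] that hd ne by (simp add: prod_eq_iff nth_map)
  qed
  have sp: "set p = (\<lambda>(i, j). (?xs ! i, ?xs ! j)) ` cycle_arcs (length ?xs)"
  proof -
    have "set p = (\<lambda>i. p ! i) ` {..<length p}" by (auto simp: set_conv_nth)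
    also have "\<dots> = (\<lambda>i. (?xs ! i, ?xs ! (Suc i mod length p))) ` {..<length p}"
      by (rule image_cong) (simp_all only: arc lessThan_iff)
    also have "\<dots> = (\<lambda>(i, j). (?xs ! i, ?xs ! j)) ` ((\<lambda>i. (i, Suc i mod length p)) ` {..<length p})"
      by (simp only: image_image prod.case)
    also have "(\<lambda>i. (i, Suc i mod length p)) ` {..<length p} = cycle_arcs (length ?xs)"
      by (auto simp: cycle_arcs_def)
    finally show ?thesis .
  qed
  have pxs: "set p \<subseteq> set ?xs \<times> set ?xs"
  proof
    fix e assume "e \<in> set p"
    then obtain i where i: "i < length p" "e = p ! i" by (auto simp: in_set_conv_nth)
    then have "Suc i mod length p < length ?xs" by (cases p) auto
    then show "e \<in> set ?xs \<times> set ?xs" using i arc[OF i(1)] nth_mem by (metis SigmaI length_map)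
  qed
  show ?thesis
  proof
    show "parcs C = (\<Union>(i, j)\<in>cycle_arcs (length ?xs). {(?xs ! i, ?xs ! j), (?xs ! j, ?xs ! i)})"
      unfolding C walk_subgraph_def by (auto simp: sp)
    show "parcs C \<subseteq> set ?xs \<times> set ?xs"
      using pxs by (force simp: C walk_subgraph_def)
    show "set ?xs \<subseteq> pverts G" using pE arc_fst_in_verts by force
    show "parcs C \<subseteq> parcs G" using pE by (auto simp: C walk_subgraph_def intro: arcs_symmetric)
  qed (use dist ne in \<open>auto simp: C walk_subgraph_def\<close>)
qed

text \<open>
  Closing a path in \<open>R\<close> by the arc \<open>(v, u)\<close> gives a cycle, which has length at least 3 because
  \<open>(u, v)\<close> is not in \<open>R\<close>.
\<close>

lemma (in pair_graph) arc_in_unique_cycle: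
  assumes uni: "unicyclic G" "C \<in> graph_cycles G"
    and R: "R \<subseteq> parcs G" "(u, v) \<in> R\<^sup>*" "(u, v) \<notin> R"
    and vu: "(v, u) \<in> parcs G"
  shows "(v, u) \<in> parcs C"
proof -
  \<comment> \<open>The path is sought in the digraph with arcs \<open>R\<close> so that it stays
    within \<open>R\<close>. This digraph is only well-formed: \<open>R\<close> may contain an arc
    without its reverse.\<close>
  let ?H = "\<lparr> pverts = pverts G, parcs = R \<rparr>"
  interpret H: pair_wf_digraph ?H
    by unfold_locales (use R(1) arc_fst_in_verts arc_snd_in_verts in force)+
  have "u \<noteq> v" using vu pair_no_loops by force
  have V: "u \<in> pverts G" "v \<in> pverts G" using vu by (auto dest: in_arcsD1 in_arcsD2)
  have "u \<rightarrow>\<^sup>*\<^bsub>with_proj ?H\<^esub> v"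
    using R(2)
  proof (induction rule: rtrancl_induct)
    case base
    show ?case using V by simp
  next
    case (step y z)
    then show ?case by (metis H.reachable_adj_trans select_convs(2) pair_pre_digraph.select_convs(2))
  qed
  then obtain p where p: "H.apath u p v" using H.reachable_apath by blast
  have Rp: "set p \<subseteq> R" and cas: "pcas u p v" and dist: "distinct (awalk_verts u p)"
    using p by (auto simp: H.apath_def H.awalk_def)
  have "p \<noteq> []" using cas \<open>u \<noteq> v\<close> by auto
  moreover have "length p \<noteq> 1"
  proof
    assume "length p = 1"
    then obtain e where "p = [e]" by (auto simp: length_Suc_conv)
    then show False using cas Rp R(3) by (cases e) auto
  qed
  ultimately have len: "3 \<le> length ((v, u) # p)" by (cases p; cases "tl p") auto
  have "awalk v ((v, u) # p) v"
    using vu V R(1) Rp cas by (auto simp: awalk_def)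
  \<comment> \<open>Without its first entry, the vertex list of the closed walk is that of the path,
    hence distinct.\<close>
  then have "cycle ((v, u) # p)" using dist by (auto simp: cycle_def)
  then have "walk_subgraph ((v, u) # p) \<in> graph_cycles G"
    using len unfolding graph_cycles_def by blast
  then have "C = walk_subgraph ((v, u) # p)" using uni by (auto simp: unicyclic_def)
  then show ?thesis by (simp add: walk_subgraph_def)
qed

section \<open>Growing the cycle to the whole graph\<close>

text \<open>Otherwise \<open>S\<close> would be closed under arcs and so contain every vertex
  reachable from it; by symmetry, connectedness makes all vertices reachable.\<close>

lemma (in pair_graph) ex_arc_leaving:
  assumes conn: "Digraph_Component.connected (with_proj G)"
    and S: "S \<noteq> {}" "S \<subset> pverts G"
  obtains (leaving) u v where "u \<in> S" "v \<in> pverts G - S" "(u, v) \<in> parcs G"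
proof (rule ccontr)
  assume not: "\<not> thesis"
  have closed: "v \<in> S" if "u \<in> S" "(u, v) \<in> parcs G" for u v
    using leaving[of u v] not that in_arcsD2[OF that(2)] by blast
  obtain a b where ab: "a \<in> S" "b \<in> pverts G - S" using S by blast
  have "strongly_connected (with_proj G)"
    by (rule symmetric_connected_imp_strongly_connected[OF pair_sym_arcs conn])
  then have "a \<rightarrow>\<^sup>*\<^bsub>with_proj G\<^esub> b" using ab S by (auto simp: strongly_connected_def)
  then have "b \<in> S" by (induction rule: reachable_induct) (use ab closed in auto)
  then show False using ab by simp
qed

text \<open>
  A connected subgraph containing the cycle grows to the whole graph one vertex at a time, and
  each new vertex has a single neighbor in the part already built: a second one would close
  another cycle.
\<close>

lemma (in pair_graph) card_k_colorings_extend: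
  assumes conn: "Digraph_Component.connected (with_proj G)"
    and uni: "unicyclic G" "C \<in> graph_cycles G"
    and S: "pverts C \<subseteq> S" "S \<subseteq> pverts G" "S \<noteq> {}"
    and connS: "\<And>u w. u \<in> S \<Longrightarrow> w \<in> S \<Longrightarrow> (u, w) \<in> (parcs G \<inter> S \<times> S)\<^sup>*"
  shows "card (k_colorings k (parcs G) (pverts G))
    = (k - 1) ^ card (pverts G - S) * card (k_colorings k (parcs G) S)"
  using S connS
proof (induction "card (pverts G - S)" arbitrary: S)
  case 0
  then have "S = pverts G" by auto
  then show ?case by simp
next
  case (Suc d)
  let ?E = "parcs G"
  have "S \<subset> pverts G" using Suc.hyps(2) Suc.prems(2) by auto
  then obtain w v where wv: "w \<in> S" "v \<in> pverts G - S" "(w, v) \<in> ?E"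
    using ex_arc_leaving[OF conn Suc.prems(3)] by metis
  have sym: "(b, a) \<in> ?E" if "(a, b) \<in> ?E" for a b using that by (rule arcs_symmetric)
  have nb: "u = w" if u: "u \<in> S" "(u, v) \<in> ?E" for u
  proof (rule ccontr)
    assume "u \<noteq> w"
    \<comment> \<open>Only \<open>(w, v)\<close> is added: as \<open>v \<notin> S\<close> and
      \<open>u \<noteq> w\<close>, the arc \<open>(u, v)\<close> is not in \<open>?R\<close>. Then
      \<open>(v, u)\<close> would lie on \<open>C\<close>, whose vertices are in
      \<open>S\<close>.\<close>
    let ?R = "insert (w, v) (?E \<inter> S \<times> S)"
    have "(u, w) \<in> ?R\<^sup>*" using Suc.prems(4)[OF u(1) wv(1)] rtrancl_mono[of "?E \<inter> S \<times> S" ?R] by auto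
    then have "(u, v) \<in> ?R\<^sup>*" by (rule rtrancl_into_rtrancl) simp
    then have "(v, u) \<in> parcs C"
      by (intro arc_in_unique_cycle[OF uni, of ?R]) (use wv u \<open>u \<noteq> w\<close> sym in auto)
    then have "v \<in> pverts C" using uni(2) by (elim graph_cycleE) blast
    then show False using wv Suc.prems(1) by blast
  qed
  let ?T = "insert v S"
  have fin: "finite S" using Suc.prems(2) pair_finite_verts finite_subset by blast
  have pend: "card (k_colorings k ?E ?T) = (k - 1) * card (k_colorings k ?E S)"
  proof (rule card_k_colorings_insert_pendant[OF fin])
    show "{u \<in> S. (u, v) \<in> ?E \<or> (v, u) \<in> ?E} = {w}" using nb wv sym by blast
  qed (use wv pair_no_loops in force)+
  have mono: "(a, b) \<in> (?E \<inter> ?T \<times> ?T)\<^sup>*" if "a \<in> S" "b \<in> S" for a b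
    using Suc.prems(4)[OF that] rtrancl_mono[of "?E \<inter> S \<times> S" "?E \<inter> ?T \<times> ?T"] by auto
  have arcs: "(w, v) \<in> ?E \<inter> ?T \<times> ?T" "(v, w) \<in> ?E \<inter> ?T \<times> ?T" using wv sym by auto
  \<comment> \<open>All pairs are connected through \<open>w\<close>, the neighbor of
    \<open>v\<close>.\<close>
  have connT: "(a, b) \<in> (?E \<inter> ?T \<times> ?T)\<^sup>*" if "a \<in> ?T" "b \<in> ?T" for a b
  proof -
    have "(a, w) \<in> (?E \<inter> ?T \<times> ?T)\<^sup>*" using that(1) arcs(2) mono[OF _ wv(1)] by blast
    moreover have "(w, b) \<in> (?E \<inter> ?T \<times> ?T)\<^sup>*" using that(2) arcs(1) mono[OF wv(1)] by blast
    ultimately show ?thesis by (rule rtrancl_trans)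
  qed
  have card: "card (pverts G - S) = Suc (card (pverts G - ?T))"
    using wv pair_finite_verts by (metis Diff_insert card_Suc_Diff1 finite_Diff)
  have "card (k_colorings k ?E (pverts G)) = (k - 1) ^ card (pverts G - ?T) * card (k_colorings k ?E ?T)"
  proof (rule Suc.hyps(1))
    show "d = card (pverts G - ?T)" using Suc.hyps(2) card by simp
    show "pverts C \<subseteq> ?T" "?T \<subseteq> pverts G" using Suc.prems(1,2) wv(2) by auto
  qed (use connT in blast)+
  then show ?case using pend card by simp
qed

text \<open>Uniqueness makes the cycle an induced subgraph, so its vertices are colored like an
  abstract cycle of length \<open>c\<close>; the remaining \<open>n - c\<close> vertices each
  contribute a factor \<open>k - 1\<close>.\<close>

lemma (in pair_graph) card_k_colorings_unicyclic:
  assumes conn: "Digraph_Component.connected (with_proj G)"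
    and uni: "unicyclic G" "C \<in> graph_cycles G"
    and k: "k > 0"
  defines "c \<equiv> card (pverts C)" and "n \<equiv> card (pverts G)"
  shows "0 < c" "c \<le> n"
    and "int (card (k_colorings k (parcs G) (pverts G)))
      = ((int k - 1) ^ c + (-1) ^ c * (int k - 1)) * (int k - 1) ^ (n - c)"
proof -
  obtain xs where xs: "distinct xs" "xs \<noteq> []" "pverts C = set xs"
    "set xs \<subseteq> pverts G" "parcs C \<subseteq> parcs G" "parcs C \<subseteq> set xs \<times> set xs"
    "parcs C = (\<Union>(i, j)\<in>cycle_arcs (length xs). {(xs ! i, xs ! j), (xs ! j, xs ! i)})"
    using graph_cycleE[OF uni(2)] .
  have c: "c = length xs" using xs by (simp add: c_def distinct_card)
  show "0 < c" using c xs by simp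
  show "c \<le> n" unfolding c_def n_def using xs pair_finite_verts by (simp add: card_mono)
  have symC: "(a, b) \<in> parcs C \<longleftrightarrow> (b, a) \<in> parcs C" for a b unfolding xs(7) by blast
  have reach0: "(xs ! 0, xs ! i) \<in> (parcs C)\<^sup>*" if "i < length xs" for i
    using that
  proof (induction i)
    case (Suc i)
    have "(i, Suc i) \<in> cycle_arcs (length xs)" using Suc.prems by (force simp: cycle_arcs_def)
    then have "(xs ! i, xs ! Suc i) \<in> parcs C" unfolding xs(7) by blast
    then show ?case using Suc by (meson Suc_lessD rtrancl.rtrancl_into_rtrancl)
  qed simp
  have reachC: "(a, b) \<in> (parcs C)\<^sup>*" if "a \<in> set xs" "b \<in> set xs" for a b
  proof -
    obtain i j where ij: "i < length xs" "a = xs ! i" "j < length xs" "b = xs ! j"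
      using \<open>a \<in> set xs\<close> \<open>b \<in> set xs\<close> by (auto simp: in_set_conv_nth)
    have "sym ((parcs C)\<^sup>*)" by (rule sym_rtrancl) (use symC in \<open>auto simp: sym_def\<close>)
    then have "(a, xs ! 0) \<in> (parcs C)\<^sup>*" using reach0[OF ij(1)] ij(2) by (auto dest: symD)
    then show ?thesis using reach0[OF ij(3)] ij(4) by (metis rtrancl_trans)
  qed
  \<comment> \<open>A chord and a path along \<open>C\<close> between its ends would form a second
    cycle: \<open>arc_in_unique_cycle\<close> with \<open>R = parcs C\<close>.\<close>
  have chordless: "(a, b) \<in> parcs C" if "a \<in> set xs" "b \<in> set xs" "(a, b) \<in> parcs G" for a b
  proof (rule ccontr)
    assume "(a, b) \<notin> parcs C"
    then have "(b, a) \<notin> parcs C" using symC by blast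
    then have "(a, b) \<in> parcs C"
      using arc_in_unique_cycle[OF uni xs(5) reachC[OF that(2,1)]] that(3) by blast
    then show False using \<open>(a, b) \<notin> parcs C\<close> by blast
  qed
  have conn_xs: "(a, b) \<in> (parcs G \<inter> set xs \<times> set xs)\<^sup>*" if "a \<in> set xs" "b \<in> set xs" for a b
    using reachC[OF that] rtrancl_mono[of "parcs C" "parcs G \<inter> set xs \<times> set xs"] xs(5,6) by blast
  have "card (k_colorings k (cycle_arcs (length xs)) {..<length xs})
      = card (k_colorings k (parcs G) (set xs))"
  proof (rule card_k_colorings_bij)
    show "bij_betw (nth xs) {..<length xs} (set xs)" using xs(1) by (simp add: bij_betw_nth)
    fix i j assume ij: "i \<in> {..<length xs}" "j \<in> {..<length xs}"
    have "(xs ! i, xs ! j) \<in> parcs C \<longleftrightarrow> (i, j) \<in> cycle_arcs (length xs) \<or> (j, i) \<in> cycle_arcs (length xs)"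
    proof -
      have "a < length xs \<and> b < length xs" if "(a, b) \<in> cycle_arcs (length xs)" for a b
        using that xs(2) by (auto simp: cycle_arcs_def)
      then show ?thesis using ij xs(1) unfolding xs(7) by (fastforce simp: nth_eq_iff_index_eq)
    qed
    moreover have "(xs ! a, xs ! b) \<in> parcs G \<longleftrightarrow> (xs ! a, xs ! b) \<in> parcs C"
      if "a < length xs" "b < length xs" for a b using chordless that xs(5) by auto
    ultimately show "(i, j) \<in> cycle_arcs (length xs) \<or> (j, i) \<in> cycle_arcs (length xs) \<longleftrightarrow>
        (xs ! i, xs ! j) \<in> parcs G \<or> (xs ! j, xs ! i) \<in> parcs G"
      using ij symC by auto
  qed
  moreover have "card (k_colorings k (parcs G) (pverts G))
      = (k - 1) ^ card (pverts G - set xs) * card (k_colorings k (parcs G) (set xs))"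
    by (rule card_k_colorings_extend[OF conn uni]) (use xs conn_xs in auto)
  moreover have "card (pverts G - set xs) = n - c"
    using xs(3,4) by (simp add: c_def n_def card_Diff_subset)
  ultimately show "int (card (k_colorings k (parcs G) (pverts G)))
      = ((int k - 1) ^ c + (-1) ^ c * (int k - 1)) * (int k - 1) ^ (n - c)"
    using card_k_colorings_cycle[of c k] \<open>0 < c\<close> k c by (simp add: of_nat_diff)
qed

section \<open>From the symmetric function to numbers of colorings\<close>

text \<open>This specializes the first \<open>k\<close> variables to 1 and the others to 0. The
  monomials summed over depend on the graph only through its number of vertices.\<close>

lemma (in pair_graph) card_k_colorings_chromatic:
  "int (card (k_colorings k (parcs G) (pverts G)))
    = (\<Sum>m \<in> mset ` {xs. set xs \<subseteq> {..<k} \<and> length xs = card (pverts G)}. chromatic_symmetric_function G m)"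
proof -
  let ?M = "mset ` {xs. set xs \<subseteq> {..<k} \<and> length xs = card (pverts G)}"
  let ?A = "\<lambda>m. {\<kappa> \<in> proper_colorings G. coloring_monomial G \<kappa> = m}"
  have "k_colorings k (parcs G) (pverts G) = (\<Union>m\<in>?M. ?A m)"
  proof (intro equalityI subsetI)
    fix f assume f: "f \<in> k_colorings k (parcs G) (pverts G)"
    obtain xs where xs: "mset xs = coloring_monomial G f" using ex_mset by blast
    have "set xs = f ` pverts G"
      using arg_cong[OF xs, of set_mset] pair_finite_verts by (simp add: coloring_monomial_def)
    moreover have "length xs = card (pverts G)"
      using arg_cong[OF xs, of size] by (simp add: coloring_monomial_def)
    ultimately have "coloring_monomial G f \<in> ?M"
      using f xs by (intro image_eqI[of _ _ xs]) (auto simp: k_colorings_def)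
    moreover have "f \<in> proper_colorings G"
      using f in_arcsD1 in_arcsD2 by (fastforce simp: k_colorings_def proper_colorings_def)
    ultimately show "f \<in> (\<Union>m\<in>?M. ?A m)" by blast
  next
    fix f assume "f \<in> (\<Union>m\<in>?M. ?A m)"
    then obtain xs where f: "f \<in> proper_colorings G" and xs: "set xs \<subseteq> {..<k}" "coloring_monomial G f = mset xs"
      by auto
    have "f ` pverts G \<subseteq> {..<k}"
      using arg_cong[OF xs(2), of set_mset] xs(1) pair_finite_verts by (simp add: coloring_monomial_def)
    then show "f \<in> k_colorings k (parcs G) (pverts G)"
      using f by (fastforce simp: k_colorings_def proper_colorings_def PiE_iff)
  qed
  moreover have "card (\<Union>m\<in>?M. ?A m) = (\<Sum>m\<in>?M. card (?A m))"
  proof (rule card_UN_disjoint)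
    show "finite ?M" by (intro finite_imageI finite_lists_length_eq) simp
    show "\<forall>m\<in>?M. finite (?A m)" using finite_colorings_with_monomial[OF pair_graph_axioms] by blast
  qed auto
  ultimately show ?thesis by (simp add: chromatic_symmetric_function_def)
qed

text \<open>A coefficient that is nonzero for both graphs gives colorings of both with the same
  monomial, whose degree is the number of vertices of each.\<close>

lemma chromatic_symmetric_function_eq_imp_card_eq:
  assumes G1: "pair_graph G1" and G2: "pair_graph G2"
    and eq: "chromatic_symmetric_function G1 = chromatic_symmetric_function G2"
  shows "card (pverts G1) = card (pverts G2)"
proof -
  interpret G1: pair_graph G1 by fact
  \<comment> \<open>An injective coloring is proper, since there are no loops, so its monomial
    occurs in the series of \<open>G1\<close>.\<close>
  obtain f :: "_ \<Rightarrow> nat" where f: "inj_on f (pverts G1)"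
    using finite_imp_inj_to_nat_seg[OF G1.pair_finite_verts] by blast
  let ?f = "restrict f (pverts G1)"
  let ?m = "coloring_monomial G1 ?f"
  have "?f u \<noteq> ?f v" if "(u, v) \<in> parcs G1" for u v
    using that f G1.in_arcsD1[OF that] G1.in_arcsD2[OF that] G1.pair_no_loops[OF that] by (auto dest: inj_onD)
  then have "?f \<in> proper_colorings G1" by (auto simp: proper_colorings_def simp del: restrict_apply)
  then have "?f \<in> {\<kappa> \<in> proper_colorings G1. coloring_monomial G1 \<kappa> = ?m}"
    by simp
  \<comment> \<open>Finiteness matters here: an infinite set would have \<open>card\<close>
    0.\<close>
  then have "card {\<kappa> \<in> proper_colorings G1. coloring_monomial G1 \<kappa> = ?m} \<noteq> 0"
    using finite_colorings_with_monomial[OF G1] by (metis card_0_eq empty_iff)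
  then have "chromatic_symmetric_function G2 ?m \<noteq> 0"
    using fun_cong[OF eq, of ?m] by (simp add: chromatic_symmetric_function_def)
  then obtain g where "coloring_monomial G2 g = ?m"
    by (auto simp: chromatic_symmetric_function_def card_eq_0_iff)
  then show ?thesis by (auto dest: arg_cong[of _ _ size] simp: coloring_monomial_def)
qed

section \<open>Recovering the cycle length\<close>

text \<open>Multiplied out, both sides start with \<open>2 ^ n\<close>; the remaining terms are, up
  to sign, powers of 2 with exponents \<open>n - a + 1\<close> and \<open>n - b + 1\<close>.\<close>

lemma three_colorings_formula_inj:
  assumes "a \<le> n" "b \<le> n"
    and eq: "((2::int) ^ a + (-1) ^ a * 2) * 2 ^ (n - a) = (2 ^ b + (-1) ^ b * 2) * 2 ^ (n - b)"
  shows "a = b"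
proof -
  have "(2::int) ^ c * 2 ^ (n - c) = 2 ^ n" if "c \<le> n" for c
    using that by (simp flip: power_add)
  then have "(-1) ^ a * (2::int) ^ Suc (n - a) = (-1) ^ b * 2 ^ Suc (n - b)"
    using eq assms(1,2) by (simp add: distrib_right)
  from arg_cong[OF this, of abs] have "(2::int) ^ Suc (n - a) = 2 ^ Suc (n - b)"
    by (simp add: abs_mult power_abs)
  then have "n - a = n - b" by simp
  then show ?thesis using assms(1,2) by simp
qed

theorem corollary3p5:
  fixes G1 :: "'a pair_pre_digraph" and G2 :: "'b pair_pre_digraph"
  assumes "pair_graph G1" and "pair_graph G2"
    and "Digraph_Component.connected (with_proj G1)"
    and "Digraph_Component.connected (with_proj G2)"
    and "unicyclic G1" and "unicyclic G2"
    and "C1 \<in> graph_cycles G1" and "C2 \<in> graph_cycles G2"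
    and "card (pverts C1) \<noteq> card (pverts C2)"
  shows "chromatic_symmetric_function G1 \<noteq> chromatic_symmetric_function G2"
proof
  assume eq: "chromatic_symmetric_function G1 = chromatic_symmetric_function G2"
  have n: "card (pverts G1) = card (pverts G2)"
    by (rule chromatic_symmetric_function_eq_imp_card_eq) fact+
  \<comment> \<open>Three is the least number of colors that works: two give 1 + (-1)^c, which sees
    only the parity of the cycle length, and one gives 0.\<close>
  note c1 = pair_graph.card_k_colorings_unicyclic[OF assms(1,3,5,7), of 3]
  note c2 = pair_graph.card_k_colorings_unicyclic[OF assms(2,4,6,8), of 3]
  \<comment> \<open>Equal numbers of vertices make both sums of coefficients run over the same
    monomials.\<close>
  have "int (card (k_colorings 3 (parcs G1) (pverts G1))) = int (card (k_colorings 3 (parcs G2) (pverts G2)))"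
    using eq n pair_graph.card_k_colorings_chromatic[OF assms(1)]
      pair_graph.card_k_colorings_chromatic[OF assms(2)] by simp
  then have "card (pverts C1) = card (pverts C2)"
    by (intro three_colorings_formula_inj[of _ "card (pverts G1)"]) (use c1 c2 n in simp_all)
  then show False using assms(9) by contradiction
qed

end
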